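(* Let $B$ be a lattice-ordered group. In the category $Pt_B\,\ell\mathbb{G}rp$ of points over $B$ in the category $\ell\mathbb{G}rp$ of lattice-ordered groups, subobjects have centralizers; that is, for every object of $Pt_B\,\ell\mathbb{G}rp$, each of its subobjects in $Pt_B\,\ell\mathbb{G}rp$ has a centralizer.
   Context: A lattice-ordered group is an algebra $(X,\cdot,e,(-)^{-1},\lor)$ such that $(X,\cdot,e,(-)^{-1})$ is a group, $(X,\lor)$ is a semilattice ($\lor$ is associative, commutative, idempotent), and $x(y\lor z)=xy\lor xz$, $(x\lor y)z=xz\lor yz$ for all $x,y,z$. Morphisms are the maps preserving the group product and $\lor$; this defines the category $\ell\mathbb{G}rp$. $Pt_B\,\ell\mathbb{G}rp$ has as objects the triples $(A,p,s)$ with $p\colon A\to B$, $s\colon B\to A$ morphisms of $\ell\mathbb{G}rp$ and $ps=id_B$; arrows $(A,p,s)\to(A',p',s')$ are morphisms $f\colon A\to A'$ with $p'f=p$ and $fs=s'$. It is a pointed category with zero object $(B,id_B,id_B)$; the product of $(X,q,r)$ and $(Y,q',r')$ is the pullback $X\times_B Y$ of $q$ along $q'$; an arrow $f$ is a monomorphism in $Pt_B\,\ell\mathbb{G}rp$ iff it is one in $\ell\mathbb{G}rp$. A pointed category with finite products is unital if for all objects $X,Y$ the pair $(id_X,0)\colon X\to X\times Y$, $(0,id_Y)\colon Y\to X\times Y$ is jointly extremally epimorphic (any monomorphism into $X \times Y$ through which both factor is an isomorphism); $Pt_B\,\ell\mathbb{G}rp$ is unital. In a unital category, two subobjects $a\colon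 X\rightarrowtail Z$ and $b\colon Y\rightarrowtail Z$ cooperate if there is a (necessarily unique) morphism $\varphi\colon X\times Y\to Z$ with $\varphi(id_X,0)=a$ and $\varphi(0,id_Y)=b$. The centralizer of a subobject $a$ of $Z$, if it exists, is the greatest subobject of $Z$ that cooperates with $a$. *)

theory Defs
  imports "HOL-Algebra.Group"
begin

record 'a lgroup = "'a monoid" +
  ljoin :: "'a \<Rightarrow> 'a \<Rightarrow> 'a" (infixl "\<squnion>\<^sub>l\<index>" 65)

locale lgroup = group G for G (structure) +
  assumes ljoin_closed: "\<lbrakk>x \<in> carrier G; y \<in> carrier G\<rbrakk> \<Longrightarrow> x \<squnion>\<^sub>l y \<in> carrier G"
    and ljoin_assoc: "\<lbrakk>x \<in> carrier G; y \<in> carrier G; z \<in> carrier G\<rbrakk>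
      \<Longrightarrow> (x \<squnion>\<^sub>l y) \<squnion>\<^sub>l z = x \<squnion>\<^sub>l (y \<squnion>\<^sub>l z)"
    and ljoin_comm: "\<lbrakk>x \<in> carrier G; y \<in> carrier G\<rbrakk> \<Longrightarrow> x \<squnion>\<^sub>l y = y \<squnion>\<^sub>l x"
    and ljoin_idem: "x \<in> carrier G \<Longrightarrow> x \<squnion>\<^sub>l x = x"
    and mult_ljoin_left: "\<lbrakk>x \<in> carrier G; y \<in> carrier G; z \<in> carrier G\<rbrakk>
      \<Longrightarrow> x \<otimes> (y \<squnion>\<^sub>l z) = (x \<otimes> y) \<squnion>\<^sub>l (x \<otimes> z)"
    and mult_ljoin_right: "\<lbrakk>x \<in> carrier G; y \<in> carrier G; z \<in> carrier G\<rbrakk>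
      \<Longrightarrow> (x \<squnion>\<^sub>l y) \<otimes> z = (x \<otimes> z) \<squnion>\<^sub>l (y \<otimes> z)"

definition lgroup_hom :: "'a lgroup \<Rightarrow> 'b lgroup \<Rightarrow> ('a \<Rightarrow> 'b) set" where
  "lgroup_hom G H = {f \<in> hom G H. \<forall>x\<in>carrier G. \<forall>y\<in>carrier G.
     f (x \<squnion>\<^sub>l\<^bsub>G\<^esub> y) = f x \<squnion>\<^sub>l\<^bsub>H\<^esub> f y}"

text \<open>Maps are HOL functions whose values outside the carrier are irrelevant; two arrows
  are equal in the categorical sense iff they agree on the carrier of their domain.\<close>

record ('a, 'b) point =
  obj :: "'a lgroup"
  proj :: "'a \<Rightarrow> 'b"
  sect :: "'b \<Rightarrow> 'a"

definition is_point :: "'b lgroup \<Rightarrow> ('a, 'b) point \<Rightarrow> bool" where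
  "is_point B P \<longleftrightarrow> lgroup (obj P) \<and> proj P \<in> lgroup_hom (obj P) B \<and>
     sect P \<in> lgroup_hom B (obj P) \<and> (\<forall>b\<in>carrier B. proj P (sect P b) = b)"

definition pt_hom :: "'b lgroup \<Rightarrow> ('a, 'b) point \<Rightarrow> ('c, 'b) point \<Rightarrow> ('a \<Rightarrow> 'c) set" where
  "pt_hom B P Q = {f \<in> lgroup_hom (obj P) (obj Q).
     (\<forall>x\<in>carrier (obj P). proj Q (f x) = proj P x) \<and>
     (\<forall>b\<in>carrier B. f (sect P b) = sect Q b)}"

text \<open>The zero arrow, i.e. the composite through the zero object \<open>(B, id, id)\<close>.\<close>

definition pt_zero :: "('a, 'b) point \<Rightarrow> ('c, 'b) point \<Rightarrow> 'a \<Rightarrow> 'c" where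
  "pt_zero P Q = (\<lambda>x. sect Q (proj P x))"

definition pt_prod :: "('a, 'b) point \<Rightarrow> ('c, 'b) point \<Rightarrow> ('a \<times> 'c, 'b) point" where
  "pt_prod P Q =
     \<lparr>obj = \<lparr>carrier = {(x, y). x \<in> carrier (obj P) \<and> y \<in> carrier (obj Q) \<and> proj P x = proj Q y},
              mult = (\<lambda>(x, y) (x', y'). (x \<otimes>\<^bsub>obj P\<^esub> x', y \<otimes>\<^bsub>obj Q\<^esub> y')),
              one = (\<one>\<^bsub>obj P\<^esub>, \<one>\<^bsub>obj Q\<^esub>),
              ljoin = (\<lambda>(x, y) (x', y'). (x \<squnion>\<^sub>l\<^bsub>obj P\<^esub> x', y \<squnion>\<^sub>l\<^bsub>obj Q\<^esub> y'))\<rparr>,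
      proj = (\<lambda>(x, y). proj P x),
      sect = (\<lambda>b. (sect P b, sect Q b))\<rparr>"

text \<open>A definition cannot quantify over types, so the test objects of left-cancellability
  have a fixed type. \<open>'a \<times> 'a\<close> is large enough to contain the kernel pair of \<open>f\<close>;
  lemma \<open>pt_mono_universal\<close> below shows that cancellability then holds against
  test objects of every type.\<close>

definition pt_mono :: "'b lgroup \<Rightarrow> ('a, 'b) point \<Rightarrow> ('c, 'b) point \<Rightarrow> ('a \<Rightarrow> 'c) \<Rightarrow> bool" where
  "pt_mono B P Q f \<longleftrightarrow> f \<in> pt_hom B P Q \<and>
     (\<forall>(W :: ('a \<times> 'a, 'b) point) g h.
        is_point B W \<and> g \<in> pt_hom B W P \<and> h \<in> pt_hom B W P \<and>
        (\<forall>w\<in>carrier (obj W). f (g w) = f (h w)) \<longrightarrow>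
        (\<forall>w\<in>carrier (obj W). g w = h w))"

text \<open>Subobjects are represented by monomorphisms.\<close>

definition is_subobject :: "'b lgroup \<Rightarrow> ('a, 'b) point \<Rightarrow> ('c, 'b) point \<Rightarrow> ('c \<Rightarrow> 'a) \<Rightarrow> bool" where
  "is_subobject B Z X a \<longleftrightarrow> is_point B X \<and> pt_mono B X Z a"

definition subobject_le ::
  "'b lgroup \<Rightarrow> ('c, 'b) point \<Rightarrow> ('c \<Rightarrow> 'a) \<Rightarrow> ('d, 'b) point \<Rightarrow> ('d \<Rightarrow> 'a) \<Rightarrow> bool" where
  "subobject_le B Y b C c \<longleftrightarrow> (\<exists>h\<in>pt_hom B Y C. \<forall>y\<in>carrier (obj Y). c (h y) = b y)"

definition cooperate :: "'b lgroup \<Rightarrow> ('a, 'b) point \<Rightarrow> ('c, 'b) point \<Rightarrow> ('c \<Rightarrow> 'a)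
    \<Rightarrow> ('d, 'b) point \<Rightarrow> ('d \<Rightarrow> 'a) \<Rightarrow> bool" where
  "cooperate B Z X a Y b \<longleftrightarrow>
     (\<exists>\<phi>\<in>pt_hom B (pt_prod X Y) Z.
        (\<forall>x\<in>carrier (obj X). \<phi> (x, pt_zero X Y x) = a x) \<and>
        (\<forall>y\<in>carrier (obj Y). \<phi> (pt_zero Y X y, y) = b y))"

text \<open>The competing subobjects are again over a fixed type, that of \<open>Z\<close>. Every subobject is
  isomorphic to the inclusion of its image, so this is no restriction; lemma
  \<open>is_centralizer_universal\<close> below proves it for competitors of every type.\<close>

definition is_centralizer :: "'b lgroup \<Rightarrow> ('a, 'b) point \<Rightarrow> ('c, 'b) point \<Rightarrow> ('c \<Rightarrow> 'a)
    \<Rightarrow> ('d, 'b) point \<Rightarrow> ('d \<Rightarrow> 'a) \<Rightarrow> bool" where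
  "is_centralizer B Z X a C c \<longleftrightarrow>
     is_subobject B Z C c \<and> cooperate B Z X a C c \<and>
     (\<forall>(Y :: ('a, 'b) point) b. is_subobject B Z Y b \<and> cooperate B Z X a Y b \<longrightarrow>
        subobject_le B Y b C c)"

lemma lgroup_hom_D:
  assumes "f \<in> lgroup_hom G H"
  shows "x \<in> carrier G \<Longrightarrow> f x \<in> carrier H"
    and "\<lbrakk>x \<in> carrier G; y \<in> carrier G\<rbrakk> \<Longrightarrow> f (x \<otimes>\<^bsub>G\<^esub> y) = f x \<otimes>\<^bsub>H\<^esub> f y"
    and "\<lbrakk>x \<in> carrier G; y \<in> carrier G\<rbrakk> \<Longrightarrow> f (x \<squnion>\<^sub>l\<^bsub>G\<^esub> y) = f x \<squnion>\<^sub>l\<^bsub>H\<^esub> f y"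
  using assms by (auto simp: lgroup_hom_def hom_def)

lemma lgroup_hom_I:
  assumes "\<And>x. x \<in> carrier G \<Longrightarrow> f x \<in> carrier H"
    and "\<And>x y. \<lbrakk>x \<in> carrier G; y \<in> carrier G\<rbrakk> \<Longrightarrow> f (x \<otimes>\<^bsub>G\<^esub> y) = f x \<otimes>\<^bsub>H\<^esub> f y"
    and "\<And>x y. \<lbrakk>x \<in> carrier G; y \<in> carrier G\<rbrakk> \<Longrightarrow> f (x \<squnion>\<^sub>l\<^bsub>G\<^esub> y) = f x \<squnion>\<^sub>l\<^bsub>H\<^esub> f y"
  shows "f \<in> lgroup_hom G H"
  using assms by (auto simp: lgroup_hom_def hom_def)

lemma lgroup_hom_comp:
  "\<lbrakk>f \<in> lgroup_hom G H; g \<in> lgroup_hom H K\<rbrakk> \<Longrightarrow> (\<lambda>x. g (f x)) \<in> lgroup_hom G K"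
  by (rule lgroup_hom_I) (simp_all add: lgroup_hom_D)

lemma pt_hom_comp:
  "\<lbrakk>f \<in> pt_hom B P Q; g \<in> pt_hom B Q R\<rbrakk> \<Longrightarrow> (\<lambda>x. g (f x)) \<in> pt_hom B P R"
  by (auto simp: pt_hom_def lgroup_hom_comp lgroup_hom_D)

lemma lgroup_hom_one:
  assumes "lgroup G" "lgroup H" "f \<in> lgroup_hom G H"
  shows "f \<one>\<^bsub>G\<^esub> = \<one>\<^bsub>H\<^esub>"
  using assms hom_one[of f G H] by (auto simp: lgroup_def lgroup_hom_def)

lemma lgroup_hom_inv:
  assumes "lgroup G" "lgroup H" "f \<in> lgroup_hom G H" "x \<in> carrier G"
  shows "f (inv\<^bsub>G\<^esub> x) = inv\<^bsub>H\<^esub> f x"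
proof -
  interpret group_hom G H f
    using assms by (auto simp: lgroup_def lgroup_hom_def group_hom_def group_hom_axioms_def)
  show ?thesis using assms(4) by simp
qed

lemma lgroup_restrict:
  fixes G :: "'a lgroup"
  assumes G: "lgroup G" and S: "subgroup S G"
    and J: "\<And>x y. \<lbrakk>x \<in> S; y \<in> S\<rbrakk> \<Longrightarrow> x \<squnion>\<^sub>l\<^bsub>G\<^esub> y \<in> S"
  shows "lgroup (G\<lparr>carrier := S\<rparr>)"
proof -
  interpret lgroup G by fact
  interpret S: subgroup S G by fact
  have "group (G\<lparr>carrier := S\<rparr>)" by (rule S.subgroup_is_group) unfold_locales
  then show ?thesis
    using J by (auto simp: lgroup_def lgroup_axioms_def S.mem_carrier ljoin_assoc ljoin_idem
        mult_ljoin_left mult_ljoin_right intro: ljoin_comm)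
qed

lemma is_point_restrict:
  fixes Z :: "('a, 'b) point"
  assumes Z: "is_point B Z" and S: "subgroup S (obj Z)"
    and J: "\<And>x y. \<lbrakk>x \<in> S; y \<in> S\<rbrakk> \<Longrightarrow> x \<squnion>\<^sub>l\<^bsub>obj Z\<^esub> y \<in> S"
    and s: "\<And>b. b \<in> carrier B \<Longrightarrow> sect Z b \<in> S"
  shows "is_point B (Z\<lparr>obj := (obj Z)\<lparr>carrier := S\<rparr>\<rparr>)"
  using Z lgroup_restrict[OF _ S J] s subgroup.subset[OF S]
  by (auto simp: is_point_def lgroup_hom_def hom_def Pi_iff subset_iff)

lemma is_point_prod:
  fixes X :: "('a, 'b) point" and Y :: "('c, 'b) point"
  assumes B: "lgroup B" and X: "is_point B X" and Y: "is_point B Y"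
  shows "is_point B (pt_prod X Y)"
proof -
  interpret B: lgroup B by fact
  interpret X: lgroup "obj X" using X by (simp add: is_point_def)
  interpret Y: lgroup "obj Y" using Y by (simp add: is_point_def)
  have p: "proj X \<in> lgroup_hom (obj X) B" "proj Y \<in> lgroup_hom (obj Y) B"
    and s: "sect X \<in> lgroup_hom B (obj X)" "sect Y \<in> lgroup_hom B (obj Y)"
    and ps: "\<And>b. b \<in> carrier B \<Longrightarrow> proj X (sect X b) = b"
      "\<And>b. b \<in> carrier B \<Longrightarrow> proj Y (sect Y b) = b"
    using X Y by (auto simp: is_point_def)
  note pD = lgroup_hom_D[OF p(1)] lgroup_hom_D[OF p(2)]
  have one: "proj X \<one>\<^bsub>obj X\<^esub> = \<one>\<^bsub>B\<^esub>" "proj Y \<one>\<^bsub>obj Y\<^esub> = \<one>\<^bsub>B\<^esub>"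
    using lgroup_hom_one[OF X.lgroup_axioms B p(1)] lgroup_hom_one[OF Y.lgroup_axioms B p(2)] by auto
  have inv: "\<And>x. x \<in> carrier (obj X) \<Longrightarrow> proj X (inv\<^bsub>obj X\<^esub> x) = inv\<^bsub>B\<^esub> proj X x"
    "\<And>y. y \<in> carrier (obj Y) \<Longrightarrow> proj Y (inv\<^bsub>obj Y\<^esub> y) = inv\<^bsub>B\<^esub> proj Y y"
    using lgroup_hom_inv[OF X.lgroup_axioms B p(1)] lgroup_hom_inv[OF Y.lgroup_axioms B p(2)] by auto
  have "group (obj (pt_prod X Y))"
  proof (rule groupI)
    fix z assume "z \<in> carrier (obj (pt_prod X Y))"
    then obtain x y where z: "z = (x, y)" "x \<in> carrier (obj X)" "y \<in> carrier (obj Y)"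
      "proj X x = proj Y y" by (auto simp: pt_prod_def)
    then show "\<exists>w\<in>carrier (obj (pt_prod X Y)). w \<otimes>\<^bsub>obj (pt_prod X Y)\<^esub> z = \<one>\<^bsub>obj (pt_prod X Y)\<^esub>"
      by (intro bexI[of _ "(inv\<^bsub>obj X\<^esub> x, inv\<^bsub>obj Y\<^esub> y)"]) (auto simp: pt_prod_def inv)
  qed (auto simp: pt_prod_def pD one X.m_assoc Y.m_assoc)
  then have "lgroup (obj (pt_prod X Y))"
    by (auto simp: lgroup_def lgroup_axioms_def pt_prod_def pD
        X.ljoin_closed X.ljoin_assoc X.ljoin_idem X.mult_ljoin_left X.mult_ljoin_right
        Y.ljoin_closed Y.ljoin_assoc Y.ljoin_idem Y.mult_ljoin_left Y.mult_ljoin_right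
        intro: X.ljoin_comm Y.ljoin_comm)
  moreover have "proj (pt_prod X Y) \<in> lgroup_hom (obj (pt_prod X Y)) B"
    by (rule lgroup_hom_I) (auto simp: pt_prod_def pD)
  moreover have "sect (pt_prod X Y) \<in> lgroup_hom B (obj (pt_prod X Y))"
    by (rule lgroup_hom_I)
      (auto simp: pt_prod_def lgroup_hom_D[OF s(1)] lgroup_hom_D[OF s(2)] ps)
  ultimately show ?thesis by (auto simp: is_point_def pt_prod_def ps)
qed

lemma pt_mono_imp_inj_on:
  fixes X :: "('a, 'b) point" and Z :: "('c, 'b) point"
  assumes B: "lgroup B" and X: "is_point B X" and Z: "is_point B Z" and f: "pt_mono B X Z f"
  shows "inj_on f (carrier (obj X))"
proof (rule inj_onI)
  fix x y assume xy: "x \<in> carrier (obj X)" "y \<in> carrier (obj X)" "f x = f y"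
  interpret Z: lgroup "obj Z" using Z by (simp add: is_point_def)
  define K where "K = {(x, y). x \<in> carrier (obj X) \<and> y \<in> carrier (obj X) \<and> f x = f y}"
  define P where "P = pt_prod X X"
  have fh: "f \<in> pt_hom B X Z" using f by (simp add: pt_mono_def)
  then have fl: "f \<in> lgroup_hom (obj X) (obj Z)" by (simp add: pt_hom_def)
  have lX: "lgroup (obj X)" and lZ: "lgroup (obj Z)" using X Z by (auto simp: is_point_def)
  interpret X: lgroup "obj X" by fact
  have P: "is_point B P" unfolding P_def by (rule is_point_prod[OF B X X])
  interpret P: lgroup "obj P" using P by (simp add: is_point_def)
  have KP: "K \<subseteq> carrier (obj P)"
    using fh by (auto simp: K_def P_def pt_prod_def pt_hom_def) metis
  have invP: "inv\<^bsub>obj P\<^esub> (u, v) = (inv\<^bsub>obj X\<^esub> u, inv\<^bsub>obj X\<^esub> v)" if "(u, v) \<in> K" for u v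
  proof (rule P.inv_equality)
    have "(inv\<^bsub>obj X\<^esub> u, inv\<^bsub>obj X\<^esub> v) \<in> K"
      using that by (auto simp: K_def lgroup_hom_inv[OF lX lZ fl])
    then show "(inv\<^bsub>obj X\<^esub> u, inv\<^bsub>obj X\<^esub> v) \<in> carrier (obj P)" using KP by auto
  qed (use that KP in \<open>auto simp: K_def P_def pt_prod_def\<close>)
  have sub: "subgroup K (obj P)"
  proof (rule P.subgroupI)
    show "K \<noteq> {}" using xy by (auto simp: K_def)
    show "inv\<^bsub>obj P\<^esub> a \<in> K" if "a \<in> K" for a
      using that invP[of "fst a" "snd a"] by (auto simp: K_def lgroup_hom_inv[OF lX lZ fl])
    show "a \<otimes>\<^bsub>obj P\<^esub> b \<in> K" if "a \<in> K" "b \<in> K" for a b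
      using that by (auto simp: K_def P_def pt_prod_def lgroup_hom_D[OF fl])
  qed fact
  have sX: "\<And>b. b \<in> carrier B \<Longrightarrow> sect X b \<in> carrier (obj X)"
    using X by (auto simp: is_point_def lgroup_hom_D)
  define W where "W = P\<lparr>obj := (obj P)\<lparr>carrier := K\<rparr>\<rparr>"
  have W: "is_point B W" unfolding W_def
    by (rule is_point_restrict[OF P sub])
      (auto simp: K_def P_def pt_prod_def lgroup_hom_D[OF fl] X.ljoin_closed sX)
  have *: "fst \<in> pt_hom B W X" "snd \<in> pt_hom B W X"
    using KP by (auto simp: W_def P_def pt_prod_def pt_hom_def K_def subset_iff intro!: lgroup_hom_I)
  have "\<forall>w\<in>carrier (obj W). f (fst w) = f (snd w)" by (auto simp: W_def K_def)
  then have "\<forall>w\<in>carrier (obj W). fst w = snd w"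
    using f W * unfolding pt_mono_def by blast
  then show "x = y" using xy by (auto simp: W_def K_def)
qed

lemma pt_mono_universal:
  fixes X :: "('a, 'b) point" and Z :: "('c, 'b) point" and W :: "('w, 'b) point"
  assumes "lgroup B" "is_point B X" "is_point B Z" "pt_mono B X Z f"
    and "is_point B W" "g \<in> pt_hom B W X" "h \<in> pt_hom B W X"
    and "\<forall>w\<in>carrier (obj W). f (g w) = f (h w)"
  shows "\<forall>w\<in>carrier (obj W). g w = h w"
  using pt_mono_imp_inj_on[OF assms(1-4)] assms(6-8)
  by (auto simp: inj_on_def pt_hom_def lgroup_hom_D)

lemma is_centralizer_universal:
  fixes Z :: "('a, 'b) point" and X :: "('c, 'b) point" and C :: "('d, 'b) point"
    and Y :: "('y, 'b) point"
  assumes B: "lgroup B" and Z: "is_point B Z" and X: "is_subobject B Z X a"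
    and C: "is_centralizer B Z X a C c"
    and Y: "is_subobject B Z Y b" and co: "cooperate B Z X a Y b"
  shows "subobject_le B Y b C c"
proof -
  have PX: "is_point B X" and PY: "is_point B Y" and mY: "pt_mono B Y Z b"
    using X Y by (auto simp: is_subobject_def)
  then have bh: "b \<in> pt_hom B Y Z" by (simp add: pt_mono_def)
  then have bl: "b \<in> lgroup_hom (obj Y) (obj Z)" by (simp add: pt_hom_def)
  have lY: "lgroup (obj Y)" and lZ: "lgroup (obj Z)" using PY Z by (auto simp: is_point_def)
  interpret Y: lgroup "obj Y" by fact
  interpret Z: lgroup "obj Z" by fact
  define S where "S = b ` carrier (obj Y)"
  define Y' where "Y' = Z\<lparr>obj := (obj Z)\<lparr>carrier := S\<rparr>\<rparr>"
  define r where "r = inv_into (carrier (obj Y)) b"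
  have inj: "inj_on b (carrier (obj Y))" by (rule pt_mono_imp_inj_on[OF B PY Z mY])
  have rb: "r (b y) = y" if "y \<in> carrier (obj Y)" for y
    using that inj by (simp add: r_def)
  have sub: "subgroup S (obj Z)"
  proof (rule Z.subgroupI)
    show "inv\<^bsub>obj Z\<^esub> u \<in> S" if "u \<in> S" for u
      using that lgroup_hom_inv[OF lY lZ bl, symmetric] by (auto simp: S_def)
    show "u \<otimes>\<^bsub>obj Z\<^esub> v \<in> S" if "u \<in> S" "v \<in> S" for u v
      using that lgroup_hom_D(2)[OF bl, symmetric] by (auto simp: S_def)
  qed (use lgroup_hom_D(1)[OF bl] Y.one_closed in \<open>auto simp: S_def\<close>)
  have SJ: "u \<squnion>\<^sub>l\<^bsub>obj Z\<^esub> v \<in> S" if uv: "u \<in> S" "v \<in> S" for u v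
  proof -
    obtain x y where "x \<in> carrier (obj Y)" "y \<in> carrier (obj Y)" "u = b x" "v = b y"
      using uv by (auto simp: S_def)
    then show ?thesis
      unfolding S_def by (intro image_eqI[of _ _ "x \<squnion>\<^sub>l\<^bsub>obj Y\<^esub> y"])
        (simp_all add: lgroup_hom_D(3)[OF bl] Y.ljoin_closed)
  qed
  have sY: "\<And>x. x \<in> carrier B \<Longrightarrow> sect Y x \<in> carrier (obj Y)"
    using PY by (auto simp: is_point_def lgroup_hom_D)
  have sb: "\<And>x. x \<in> carrier B \<Longrightarrow> sect Z x = b (sect Y x)"
    using bh by (auto simp: pt_hom_def)
  have PY': "is_point B Y'" unfolding Y'_def
    by (rule is_point_restrict[OF Z sub]) (simp_all add: SJ, simp add: S_def sY sb)
  have id: "(\<lambda>x. x) \<in> pt_hom B Y' Z"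
    using subgroup.subset[OF sub] by (auto simp: pt_hom_def Y'_def intro!: lgroup_hom_I)
  then have sY': "is_subobject B Z Y' (\<lambda>x. x)"
    using PY' by (auto simp: is_subobject_def pt_mono_def)
  have bY': "b \<in> pt_hom B Y Y'"
    using bh by (auto simp: pt_hom_def Y'_def S_def lgroup_hom_D[OF bl] intro!: lgroup_hom_I)
  have rY: "r \<in> pt_hom B Y' Y"
  proof -
    have "r \<in> lgroup_hom (obj Y') (obj Y)"
      by (rule lgroup_hom_I)
        (auto simp: Y'_def S_def rb Y.ljoin_closed simp flip: lgroup_hom_D(2,3)[OF bl])
    then show ?thesis using bh by (auto simp: pt_hom_def Y'_def S_def rb sb sY)
  qed
  obtain \<phi> where \<phi>: "\<phi> \<in> pt_hom B (pt_prod X Y) Z"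
    "\<And>x. x \<in> carrier (obj X) \<Longrightarrow> \<phi> (x, pt_zero X Y x) = a x"
    "\<And>y. y \<in> carrier (obj Y) \<Longrightarrow> \<phi> (pt_zero Y X y, y) = b y"
    using co by (auto simp: cooperate_def)
  have q: "(\<lambda>(x, y). (x, r y)) \<in> pt_hom B (pt_prod X Y') (pt_prod X Y)"
    using rY by (auto simp: pt_hom_def pt_prod_def lgroup_hom_D intro!: lgroup_hom_I)
  have pX: "\<And>x. x \<in> carrier (obj X) \<Longrightarrow> proj X x \<in> carrier B"
    using PX by (auto simp: is_point_def lgroup_hom_D)
  have "cooperate B Z X a Y' (\<lambda>x. x)"
    unfolding cooperate_def
  proof (intro bexI conjI ballI)
    show "(\<lambda>w. \<phi> ((\<lambda>(x, y). (x, r y)) w)) \<in> pt_hom B (pt_prod X Y') Z"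
      by (rule pt_hom_comp[OF q \<phi>(1)])
    show "\<phi> ((\<lambda>(x, y). (x, r y)) (x, pt_zero X Y' x)) = a x" if "x \<in> carrier (obj X)" for x
      using that rY pX \<phi>(2)[OF that] by (auto simp: pt_zero_def pt_hom_def)
    show "\<phi> ((\<lambda>(x, y). (x, r y)) (pt_zero Y' X y, y)) = y" if y: "y \<in> carrier (obj Y')" for y
    proof -
      obtain y0 where y0: "y0 \<in> carrier (obj Y)" "y = b y0" using y by (auto simp: Y'_def S_def)
      have "proj Z y = proj Y y0" using y0 bh by (auto simp: pt_hom_def)
      then show ?thesis using \<phi>(3)[OF y0(1)] y0 by (auto simp: pt_zero_def Y'_def rb)
    qed
  qed
  then obtain h where h: "h \<in> pt_hom B Y' C" "\<And>y. y \<in> carrier (obj Y') \<Longrightarrow> c (h y) = y"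
    using C sY' unfolding is_centralizer_def subobject_le_def by blast
  show ?thesis unfolding subobject_le_def
    by (rule bexI[OF _ pt_hom_comp[OF bY' h(1)]]) (auto simp: h(2) Y'_def S_def)
qed

end

theory Submission
  imports Defs
begin

text \<open>Write \<open>K\<close> for the kernel of \<open>p\<close> and \<open>s\<close> for the section. If \<open>X\<close> and \<open>Y\<close> cooperate, then
  positive elements of \<open>X \<inter> K\<close> and of \<open>Y \<inter> K\<close> have meet \<open>\<one>\<close>, so \<open>Y \<inter> K\<close> lies in the
  polar of \<open>X \<inter> K\<close>. Conversely, let \<open>L\<close> be this polar: it is a convex \<open>\<ell>\<close>-subgroup, stable
  under conjugation by \<open>s(B)\<close> because \<open>X \<inter> K\<close> is, and convexity makes \<open>L s(B)\<close> closed under joins.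
  The map \<open>(h b, l b) \<mapsto> h l b\<close> is then a cooperator. It is multiplicative as orthogonal
  elements commute, and it preserves joins as the defect
  \<open>(h c \<squnion> \<one>) (c \<squnion> \<one>)\<inverse>\<close>, lying between \<open>\<one>\<close> and \<open>h\<close> when \<open>\<one> \<le> h\<close>, does not change
  when \<open>c\<close> is replaced by \<open>l c\<close> with \<open>l\<close> orthogonal to \<open>h\<close>. Hence \<open>L s(B)\<close> is the centralizer.\<close>

section \<open>The order of a lattice-ordered group\<close>

context lgroup
begin

declare ljoin_closed [simp, intro] ljoin_idem [simp]

lemma mult_inv_cancel [simp]:
  assumes "x \<in> carrier G" "y \<in> carrier G"
  shows "x \<otimes> (inv x \<otimes> y) = y" "inv x \<otimes> (x \<otimes> y) = y"
  using assms by (simp_all flip: m_assoc)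

definition le :: "'a \<Rightarrow> 'a \<Rightarrow> bool" (infix "\<preceq>" 50) where
  "x \<preceq> y \<longleftrightarrow> x \<squnion>\<^sub>l y = y"

lemma le_trans:
  assumes "x \<preceq> y" "y \<preceq> z" "x \<in> carrier G" "y \<in> carrier G" "z \<in> carrier G"
  shows "x \<preceq> z"
  using assms ljoin_assoc[of x y z] by (simp add: le_def)

lemma le_antisym: "\<lbrakk>x \<preceq> y; y \<preceq> x; x \<in> carrier G; y \<in> carrier G\<rbrakk> \<Longrightarrow> x = y"
  using ljoin_comm[of x y] by (simp add: le_def)

lemma le_refl [simp]: "x \<in> carrier G \<Longrightarrow> x \<preceq> x"
  by (simp add: le_def)

lemma ljoin_upper1 [simp]: "\<lbrakk>x \<in> carrier G; y \<in> carrier G\<rbrakk> \<Longrightarrow> x \<preceq> x \<squnion>\<^sub>l y"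
  using ljoin_assoc[of x x y] by (simp add: le_def)

lemma ljoin_upper2 [simp]: "\<lbrakk>x \<in> carrier G; y \<in> carrier G\<rbrakk> \<Longrightarrow> y \<preceq> x \<squnion>\<^sub>l y"
  using ljoin_upper1[of y x] ljoin_comm[of x y] by simp

lemma ljoin_least:
  "\<lbrakk>x \<preceq> z; y \<preceq> z; x \<in> carrier G; y \<in> carrier G; z \<in> carrier G\<rbrakk> \<Longrightarrow> x \<squnion>\<^sub>l y \<preceq> z"
  using ljoin_assoc[of x y z] by (simp add: le_def)

lemma ljoin_mono:
  assumes "x \<preceq> x'" "y \<preceq> y'"
    and "x \<in> carrier G" "y \<in> carrier G" "x' \<in> carrier G" "y' \<in> carrier G"
  shows "x \<squnion>\<^sub>l y \<preceq> x' \<squnion>\<^sub>l y'"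
  using assms by (intro ljoin_least) (auto intro: le_trans[OF _ ljoin_upper1] le_trans[OF _ ljoin_upper2])

lemma mult_le_left:
  "\<lbrakk>x \<preceq> y; x \<in> carrier G; y \<in> carrier G; z \<in> carrier G\<rbrakk> \<Longrightarrow> z \<otimes> x \<preceq> z \<otimes> y"
  by (simp add: le_def flip: mult_ljoin_left)

lemma mult_le_right:
  "\<lbrakk>x \<preceq> y; x \<in> carrier G; y \<in> carrier G; z \<in> carrier G\<rbrakk> \<Longrightarrow> x \<otimes> z \<preceq> y \<otimes> z"
  by (simp add: le_def flip: mult_ljoin_right)

lemma mult_mono:
  assumes "x \<preceq> x'" "y \<preceq> y'"
    and "x \<in> carrier G" "y \<in> carrier G" "x' \<in> carrier G" "y' \<in> carrier G"
  shows "x \<otimes> y \<preceq> x' \<otimes> y'"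
  using assms by (intro le_trans[OF mult_le_left[of y y' x] mult_le_right[of x x' y']]) auto

lemma mult_upper1: "\<lbrakk>\<one> \<preceq> y; x \<in> carrier G; y \<in> carrier G\<rbrakk> \<Longrightarrow> x \<preceq> x \<otimes> y"
  using mult_le_left[of \<one> y x] by simp

lemma mult_upper2: "\<lbrakk>\<one> \<preceq> x; x \<in> carrier G; y \<in> carrier G\<rbrakk> \<Longrightarrow> y \<preceq> x \<otimes> y"
  using mult_le_right[of \<one> x y] by simp

lemma le_mult_inv:
  "\<lbrakk>x \<preceq> y \<otimes> z; x \<in> carrier G; y \<in> carrier G; z \<in> carrier G\<rbrakk> \<Longrightarrow> x \<otimes> inv z \<preceq> y"
  using mult_le_right[of x "y \<otimes> z" "inv z"] by (simp add: m_assoc)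

lemma inv_antimono: "\<lbrakk>x \<preceq> y; x \<in> carrier G; y \<in> carrier G\<rbrakk> \<Longrightarrow> inv y \<preceq> inv x"
  using mult_le_right[OF mult_le_left[of x y "inv y"], of "inv x"]
  by (simp add: m_assoc)

lemma inv_le_one: "\<lbrakk>\<one> \<preceq> x; x \<in> carrier G\<rbrakk> \<Longrightarrow> inv x \<preceq> \<one>"
  using inv_antimono[of \<one> x] by simp

lemma one_le_inv_iff: "x \<in> carrier G \<Longrightarrow> inv x \<preceq> \<one> \<longleftrightarrow> \<one> \<preceq> x"
  using inv_antimono[of \<one> x] inv_antimono[of "inv x" \<one>] by auto

text \<open>Distributing \<open>x\<close> over the join turns
  \<open>inv x \<squnion>\<^sub>l \<one>\<close> into \<open>x \<squnion>\<^sub>l \<one>\<close>.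
  Writing \<open>x\<close> as a quotient of positive elements reduces later claims to positive
  arguments.\<close>

lemma pos_neg_parts:
  assumes "x \<in> carrier G"
  shows "x = (x \<squnion>\<^sub>l \<one>) \<otimes> inv (inv x \<squnion>\<^sub>l \<one>)"
proof (rule inv_solve_right[THEN iffD2])
  show "x \<squnion>\<^sub>l \<one> = x \<otimes> (inv x \<squnion>\<^sub>l \<one>)"
    using assms by (simp add: mult_ljoin_left ljoin_comm)
qed (use assms in auto)

section \<open>Orthogonal positive elements\<close>

text \<open>Equivalently \<open>x\<close> and \<open>y\<close> are positive with meet \<open>\<one>\<close>; in this form positivity
  follows and no meet operation is needed.\<close>

definition orth :: "'a \<Rightarrow> 'a \<Rightarrow> bool" where
  "orth x y \<longleftrightarrow> inv x \<squnion>\<^sub>l inv y = \<one>"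

lemma orth_sym: "\<lbrakk>orth x y; x \<in> carrier G; y \<in> carrier G\<rbrakk> \<Longrightarrow> orth y x"
  by (simp add: orth_def ljoin_comm)

lemma orth_one_le:
  assumes "orth x y" "x \<in> carrier G" "y \<in> carrier G"
  shows "\<one> \<preceq> x" "\<one> \<preceq> y"
  using assms ljoin_upper1[of "inv x" "inv y"] ljoin_upper2[of "inv x" "inv y"]
  by (auto simp: orth_def simp flip: one_le_inv_iff)

text \<open>Insert \<open>inv x \<squnion>\<^sub>l inv y\<close>, which is \<open>\<one>\<close>,
  between the two factors and distribute.\<close>

lemma orth_mult_eq_ljoin:
  assumes "orth x y" "x \<in> carrier G" "y \<in> carrier G"
  shows "x \<otimes> y = x \<squnion>\<^sub>l y"
proof -
  have "x \<otimes> y = x \<otimes> (inv x \<squnion>\<^sub>l inv y) \<otimes> y" using assms by (simp add: orth_def)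
  also have "\<dots> = y \<squnion>\<^sub>l x" using assms by (simp add: mult_ljoin_left mult_ljoin_right m_assoc)
  finally show ?thesis using assms by (simp add: ljoin_comm)
qed

lemma orth_commute: "\<lbrakk>orth x y; x \<in> carrier G; y \<in> carrier G\<rbrakk> \<Longrightarrow> x \<otimes> y = y \<otimes> x"
  using orth_mult_eq_ljoin orth_sym ljoin_comm by metis

text \<open>Inversion reverses the order, so passing to a smaller \<open>y'\<close> can only raise
  the join of the inverses, while positivity keeps that join below \<open>\<one>\<close>.\<close>

lemma orth_le:
  assumes "orth x y" "y' \<preceq> y" "\<one> \<preceq> y'" "x \<in> carrier G" "y \<in> carrier G" "y' \<in> carrier G"
  shows "orth x y'"
  unfolding orth_def
proof (rule le_antisym)
  show "inv x \<squnion>\<^sub>l inv y' \<preceq> \<one>"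
    using assms orth_one_le[of x y] by (intro ljoin_least inv_le_one) auto
  have "inv x \<squnion>\<^sub>l inv y \<preceq> inv x \<squnion>\<^sub>l inv y'"
    using assms by (intro ljoin_mono inv_antimono) auto
  then show "\<one> \<preceq> inv x \<squnion>\<^sub>l inv y'" using assms by (simp add: orth_def)
qed (use assms in auto)

lemma orth_mult:
  assumes "orth x y" "orth x z" "x \<in> carrier G" "y \<in> carrier G" "z \<in> carrier G"
  shows "orth x (y \<otimes> z)"
  unfolding orth_def
proof (rule le_antisym)
  have pos: "\<one> \<preceq> x" "\<one> \<preceq> y" "\<one> \<preceq> z" using assms orth_one_le by blast+
  then have neg: "inv x \<preceq> \<one>" "inv y \<preceq> \<one>" "inv z \<preceq> \<one>" using assms inv_le_one by auto
  have "\<one> \<preceq> y \<otimes> z" using le_trans[OF pos(2) mult_upper1[OF pos(3)]] assms by auto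
  then show "inv x \<squnion>\<^sub>l inv (y \<otimes> z) \<preceq> \<one>"
    using assms pos by (intro ljoin_least inv_le_one) auto
  let ?r = "inv x \<squnion>\<^sub>l inv (y \<otimes> z)"
  have lx: "inv x \<preceq> ?r" and ly: "inv z \<otimes> inv y \<preceq> ?r"
    using assms ljoin_upper2[of "inv x" "inv (y \<otimes> z)"] by (simp_all add: inv_mult_group)
  \<comment> \<open>Both joins are \<open>\<one>\<close> by orthogonality. After distributing, every
    term with a factor \<open>inv x\<close> lies below \<open>inv x\<close>, the other factor being
    at most \<open>\<one>\<close>; the one remaining term is
    \<open>inv (y \<otimes> z)\<close>.\<close>
  have "\<one> = (inv x \<squnion>\<^sub>l inv z) \<otimes> (inv x \<squnion>\<^sub>l inv y)" using assms by (simp add: orth_def)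
  also have "\<dots> = (inv x \<squnion>\<^sub>l inv z) \<otimes> inv x \<squnion>\<^sub>l (inv x \<otimes> inv y \<squnion>\<^sub>l inv z \<otimes> inv y)"
    using assms by (simp add: mult_ljoin_left mult_ljoin_right)
  also have "\<dots> \<preceq> ?r"
  proof -
    have "(inv x \<squnion>\<^sub>l inv z) \<otimes> inv x \<preceq> ?r" using lx assms by (simp add: orth_def)
    moreover have "inv x \<otimes> inv y \<preceq> ?r"
      using le_trans[OF _ lx] mult_le_left[OF neg(2), of "inv x"] assms by simp
    ultimately show ?thesis using ly assms by (intro ljoin_least) auto
  qed
  finally show "\<one> \<preceq> ?r" .
qed (use assms in auto)

text \<open>Conjugation distributes over joins and fixes \<open>\<one>\<close>, so it can be shifted
  from one argument to the other.\<close>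

lemma orth_conj_iff:
  assumes "x \<in> carrier G" "y \<in> carrier G" "g \<in> carrier G"
  shows "orth x (g \<otimes> y \<otimes> inv g) \<longleftrightarrow> orth (inv g \<otimes> x \<otimes> g) y"
proof -
  have e: "inv (inv g \<otimes> x \<otimes> g) \<squnion>\<^sub>l inv y = inv g \<otimes> (inv x \<squnion>\<^sub>l inv (g \<otimes> y \<otimes> inv g)) \<otimes> g"
    using assms by (simp add: mult_ljoin_left mult_ljoin_right inv_mult_group m_assoc inv_solve_left)
  have *: "inv g \<otimes> u \<otimes> g = \<one> \<longleftrightarrow> u = \<one>" if "u \<in> carrier G" for u
  proof
    assume "inv g \<otimes> u \<otimes> g = \<one>"
    then have "g \<otimes> (inv g \<otimes> u \<otimes> g) \<otimes> inv g = \<one>" using assms by simp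
    then show "u = \<one>" using assms that by (simp add: m_assoc inv_solve_left)
  qed (use assms in simp)
  show ?thesis unfolding orth_def e using * assms by auto
qed

section \<open>The defect of positive parts under left multiplication\<close>

text \<open>The left factor that carries the positive part of \<open>c\<close> to that of
  \<open>h \<otimes> c\<close>. It is a cocycle: \<open>defect (h \<otimes> k) c = defect h (k
  \<otimes> c) \<otimes> defect k c\<close>.\<close>

definition defect :: "'a \<Rightarrow> 'a \<Rightarrow> 'a" where
  "defect h c = (h \<otimes> c \<squnion>\<^sub>l \<one>) \<otimes> inv (c \<squnion>\<^sub>l \<one>)"

lemma defect_closed [simp]: "\<lbrakk>h \<in> carrier G; c \<in> carrier G\<rbrakk> \<Longrightarrow> defect h c \<in> carrier G"
  by (simp add: defect_def)

lemma defect_mult: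
  assumes "h \<in> carrier G" "c \<in> carrier G"
  shows "defect h c \<otimes> (c \<squnion>\<^sub>l \<one>) = h \<otimes> c \<squnion>\<^sub>l \<one>"
  using assms by (simp add: defect_def m_assoc)

text \<open>The lower bound comes from \<open>c \<preceq> h \<otimes> c\<close>; for the upper one,
  \<open>\<one>\<close> is enlarged to \<open>h\<close> and \<open>h\<close> is factored out of the
  join.\<close>

lemma defect_bounds:
  assumes "\<one> \<preceq> h" "h \<in> carrier G" "c \<in> carrier G"
  shows "\<one> \<preceq> defect h c" "defect h c \<preceq> h"
proof -
  have "c \<preceq> h \<otimes> c" using assms by (rule mult_upper2)
  then have "c \<squnion>\<^sub>l \<one> \<preceq> h \<otimes> c \<squnion>\<^sub>l \<one>" using assms by (intro ljoin_mono) auto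
  from mult_le_right[OF this, of "inv (c \<squnion>\<^sub>l \<one>)"]
  show "\<one> \<preceq> defect h c" using assms by (simp add: defect_def)
  have "h \<otimes> c \<squnion>\<^sub>l \<one> \<preceq> h \<otimes> c \<squnion>\<^sub>l h" using assms by (intro ljoin_mono) auto
  then have "h \<otimes> c \<squnion>\<^sub>l \<one> \<preceq> h \<otimes> (c \<squnion>\<^sub>l \<one>)" using assms by (simp add: mult_ljoin_left)
  then show "defect h c \<preceq> h" unfolding defect_def using assms by (intro le_mult_inv) auto
qed

text \<open>The defects of \<open>h\<close> and \<open>l\<close> at \<open>c\<close> lie below
  \<open>h\<close> and \<open>l\<close>, so they are orthogonal and their product is their join.
  Multiplied by \<open>c \<squnion>\<^sub>l \<one>\<close>, this join becomes \<open>(h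
  \<squnion>\<^sub>l l) \<otimes> c \<squnion>\<^sub>l \<one>\<close>, where
  \<open>h \<squnion>\<^sub>l l\<close> is again \<open>h \<otimes> l\<close>.\<close>

lemma defect_orth:
  assumes o: "orth h l" and c: "h \<in> carrier G" "l \<in> carrier G" "c \<in> carrier G"
  shows "defect h (l \<otimes> c) = defect h c"
proof -
  note pos = orth_one_le[OF o c(1,2)]
  note dh = defect_bounds[OF pos(1) c(1,3)] and dl = defect_bounds[OF pos(2) c(2,3)]
  have "orth h (defect l c)" using orth_le[OF o dl(2,1)] c by simp
  then have "orth (defect l c) (defect h c)"
    using orth_le[OF orth_sym dh(2,1)] c by simp
  then have o': "orth (defect h c) (defect l c)" using orth_sym c by simp
  have j: "(x \<squnion>\<^sub>l \<one>) \<squnion>\<^sub>l (y \<squnion>\<^sub>l \<one>) = x \<squnion>\<^sub>l y \<squnion>\<^sub>l \<one>" if "x \<in> carrier G" "y \<in> carrier G" for x y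
    using that by (metis ljoin_assoc ljoin_closed ljoin_comm ljoin_idem one_closed)
  have "defect h c \<otimes> (l \<otimes> c \<squnion>\<^sub>l \<one>) = defect h c \<otimes> defect l c \<otimes> (c \<squnion>\<^sub>l \<one>)"
    using c by (simp add: defect_mult m_assoc)
  also have "\<dots> = (defect h c \<squnion>\<^sub>l defect l c) \<otimes> (c \<squnion>\<^sub>l \<one>)"
    using orth_mult_eq_ljoin[OF o'] c by simp
  also have "\<dots> = (h \<otimes> c \<squnion>\<^sub>l \<one>) \<squnion>\<^sub>l (l \<otimes> c \<squnion>\<^sub>l \<one>)"
    using c by (simp add: mult_ljoin_right defect_mult)
  also have "\<dots> = (h \<squnion>\<^sub>l l) \<otimes> c \<squnion>\<^sub>l \<one>" using c by (simp add: j mult_ljoin_right)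
  also have "\<dots> = h \<otimes> (l \<otimes> c) \<squnion>\<^sub>l \<one>"
    using c by (simp add: m_assoc flip: orth_mult_eq_ljoin[OF o])
  finally have "defect h c \<otimes> (l \<otimes> c \<squnion>\<^sub>l \<one>) = defect h (l \<otimes> c) \<otimes> (l \<otimes> c \<squnion>\<^sub>l \<one>)"
    using c by (simp add: defect_mult)
  then show ?thesis using c by simp
qed

text \<open>The cocycle identity for \<open>h = (h \<otimes> inv k) \<otimes> k\<close> at the point
  \<open>inv k \<otimes> c\<close>. It extends invariance from positive elements to their
  quotients.\<close>

lemma defect_diff:
  assumes "h \<in> carrier G" "k \<in> carrier G" "c \<in> carrier G"
  shows "defect (h \<otimes> inv k) c = defect h (inv k \<otimes> c) \<otimes> inv (defect k (inv k \<otimes> c))"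
  using assms by (simp add: defect_def inv_mult_group m_assoc inv_solve_left)

text \<open>Invariance under \<open>l\<close> removes \<open>l\<close>; invariance under
  \<open>m\<close>, read backwards at \<open>inv m \<otimes> c\<close>, removes
  \<open>inv m\<close>.\<close>

lemma defect_invariant_diff:
  assumes "\<And>c. c \<in> carrier G \<Longrightarrow> defect h (l \<otimes> c) = defect h c"
    and "\<And>c. c \<in> carrier G \<Longrightarrow> defect h (m \<otimes> c) = defect h c"
    and "l \<in> carrier G" "m \<in> carrier G" "c \<in> carrier G"
  shows "defect h (l \<otimes> inv m \<otimes> c) = defect h c"
  using assms(1)[of "inv m \<otimes> c"] assms(2)[of "inv m \<otimes> c"] assms(3-5)
  by (simp add: m_assoc inv_solve_left)

section \<open>Polars\<close>

text \<open>Bounding \<open>l\<close> and \<open>inv l\<close> by a common element avoids the theory of absolute values.\<close>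

definition polar :: "'a set \<Rightarrow> 'a set" where
  "polar P = {l \<in> carrier G. \<exists>m\<in>carrier G. (\<forall>h\<in>P. orth h m) \<and> l \<preceq> m \<and> inv l \<preceq> m}"

lemma polarE:
  assumes "l \<in> polar P"
  obtains m where "m \<in> carrier G" "\<And>h. h \<in> P \<Longrightarrow> orth h m" "l \<preceq> m" "inv l \<preceq> m" "l \<in> carrier G"
  using assms by (auto simp: polar_def)

text \<open>Both parts lie between \<open>\<one>\<close> and the bound \<open>m\<close>, and
  orthogonality passes down to them.\<close>

lemma polar_parts:
  assumes "l \<in> polar P" "h \<in> P" "P \<subseteq> carrier G"
  shows "orth h (l \<squnion>\<^sub>l \<one>)" "orth h (inv l \<squnion>\<^sub>l \<one>)"
proof -
  from assms obtain m where m: "m \<in> carrier G" "orth h m" "l \<preceq> m" "inv l \<preceq> m" "l \<in> carrier G"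
    by (meson polarE)
  have "h \<in> carrier G" using assms by auto
  moreover have "\<one> \<preceq> m" using orth_one_le m \<open>h \<in> carrier G\<close> by blast
  ultimately show "orth h (l \<squnion>\<^sub>l \<one>)" "orth h (inv l \<squnion>\<^sub>l \<one>)"
    using m by (auto intro!: orth_le[OF m(2)] ljoin_least)
qed

lemma commute_inv:
  assumes "x \<otimes> y = y \<otimes> x" "x \<in> carrier G" "y \<in> carrier G"
  shows "x \<otimes> inv y = inv y \<otimes> x"
  using assms by (metis inv_closed inv_solve_left inv_solve_right m_assoc m_closed)

text \<open>Orthogonal elements commute, so \<open>p\<close> commutes with both parts of
  \<open>l\<close> and hence with their quotient.\<close>

lemma polar_commute_pos:
  assumes P: "P \<subseteq> carrier G" and l: "l \<in> polar P" and p: "p \<in> P"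
  shows "p \<otimes> l = l \<otimes> p"
proof -
  have lc: "l \<in> carrier G" using l by (auto simp: polar_def)
  have pc: "p \<in> carrier G" using p P by auto
  have 1: "p \<otimes> (l \<squnion>\<^sub>l \<one>) = (l \<squnion>\<^sub>l \<one>) \<otimes> p" and 2: "p \<otimes> inv (inv l \<squnion>\<^sub>l \<one>) = inv (inv l \<squnion>\<^sub>l \<one>) \<otimes> p"
    using polar_parts[OF l p P] pc lc by (auto intro!: orth_commute commute_inv)
  have "p \<otimes> ((l \<squnion>\<^sub>l \<one>) \<otimes> inv (inv l \<squnion>\<^sub>l \<one>)) = ((l \<squnion>\<^sub>l \<one>) \<otimes> inv (inv l \<squnion>\<^sub>l \<one>)) \<otimes> p"
    using pc lc 1 2 by (metis inv_closed ljoin_closed m_assoc one_closed)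
  then show ?thesis using pos_neg_parts[OF lc] by simp
qed

lemma polar_commute:
  assumes P: "P \<subseteq> carrier G" and h: "h \<squnion>\<^sub>l \<one> \<in> P" "inv h \<squnion>\<^sub>l \<one> \<in> P" "h \<in> carrier G"
    and l: "l \<in> polar P"
  shows "h \<otimes> l = l \<otimes> h"
proof -
  have lc: "l \<in> carrier G" using l by (auto simp: polar_def)
  have 1: "l \<otimes> (h \<squnion>\<^sub>l \<one>) = (h \<squnion>\<^sub>l \<one>) \<otimes> l" and 2: "l \<otimes> inv (inv h \<squnion>\<^sub>l \<one>) = inv (inv h \<squnion>\<^sub>l \<one>) \<otimes> l"
    using polar_commute_pos[OF P l h(1)] polar_commute_pos[OF P l h(2)] h(3) lc
    by (auto intro!: commute_inv)
  have "l \<otimes> ((h \<squnion>\<^sub>l \<one>) \<otimes> inv (inv h \<squnion>\<^sub>l \<one>)) = ((h \<squnion>\<^sub>l \<one>) \<otimes> inv (inv h \<squnion>\<^sub>l \<one>)) \<otimes> l"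
    using h(3) lc 1 2 by (metis inv_closed ljoin_closed m_assoc one_closed)
  then show ?thesis using pos_neg_parts[OF h(3)] by simp
qed

text \<open>The quotient decomposition is used twice: on \<open>l\<close> against a positive
  \<open>p\<close>, and then on \<open>h\<close> through \<open>defect_diff\<close>.\<close>

lemma polar_defect:
  assumes P: "P \<subseteq> carrier G" and h: "h \<squnion>\<^sub>l \<one> \<in> P" "inv h \<squnion>\<^sub>l \<one> \<in> P" "h \<in> carrier G"
    and l: "l \<in> polar P" and c: "c \<in> carrier G"
  shows "defect h (l \<otimes> c) = defect h c"
proof -
  have lc: "l \<in> carrier G" using l by (auto simp: polar_def)
  have *: "defect p (l \<otimes> c) = defect p c" if p: "p \<in> P" and c: "c \<in> carrier G" for p c
  proof -
    have "p \<in> carrier G" using p P by auto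
    then have "defect p ((l \<squnion>\<^sub>l \<one>) \<otimes> inv (inv l \<squnion>\<^sub>l \<one>) \<otimes> c) = defect p c"
      using polar_parts[OF l p P] lc c by (intro defect_invariant_diff defect_orth) auto
    then show ?thesis using pos_neg_parts[OF lc] by simp
  qed
  let ?k = "inv h \<squnion>\<^sub>l \<one>"
  \<comment> \<open>The defects in \<open>defect_diff\<close> are taken at
    \<open>inv ?k \<otimes> (l \<otimes> c)\<close>; invariance applies only once \<open>l\<close>
    has been moved to the front.\<close>
  have "l \<otimes> ?k = ?k \<otimes> l" using polar_commute_pos[OF P l h(2)] by simp
  then have k: "inv ?k \<otimes> (l \<otimes> c) = l \<otimes> (inv ?k \<otimes> c)"
    using commute_inv[of l ?k] lc h c by (simp flip: m_assoc)
  have "defect ((h \<squnion>\<^sub>l \<one>) \<otimes> inv ?k) (l \<otimes> c) = defect ((h \<squnion>\<^sub>l \<one>) \<otimes> inv ?k) c"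
    using h lc c by (simp add: defect_diff k *)
  then show ?thesis using pos_neg_parts[OF h(3)] by simp
qed

lemma polar_subset: "polar P \<subseteq> carrier G"
  by (auto simp: polar_def)

lemma polar_one:
  assumes "P \<subseteq> carrier G" "\<And>h. h \<in> P \<Longrightarrow> \<one> \<preceq> h"
  shows "\<one> \<in> polar P"
proof -
  have "orth h \<one>" if "h \<in> P" for h
  proof -
    have "h \<in> carrier G" "\<one> \<preceq> h" using assms that by auto
    then show ?thesis using inv_le_one[of h] by (simp add: orth_def le_def)
  qed
  then show ?thesis by (auto simp: polar_def intro!: bexI[of _ \<one>])
qed

lemma polar_inv: "l \<in> polar P \<Longrightarrow> inv l \<in> polar P"
  by (auto simp: polar_def)

text \<open>The product of the two bounds lies above each of them, since both are at least
  \<open>\<one>\<close>, and it stays orthogonal to \<open>P\<close> by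
  \<open>orth_mult\<close>.\<close>

lemma polar_common_bound:
  assumes P: "P \<subseteq> carrier G" "P \<noteq> {}" and l: "l \<in> polar P" "l' \<in> polar P"
  obtains m where "m \<in> carrier G" "\<one> \<preceq> m" "\<And>h. h \<in> P \<Longrightarrow> orth h m"
    "l \<preceq> m" "inv l \<preceq> m" "l' \<preceq> m" "inv l' \<preceq> m"
proof -
  obtain m where m: "m \<in> carrier G" "\<And>h. h \<in> P \<Longrightarrow> orth h m" "l \<preceq> m" "inv l \<preceq> m" "l \<in> carrier G"
    using l by (meson polarE)
  obtain m' where m': "m' \<in> carrier G" "\<And>h. h \<in> P \<Longrightarrow> orth h m'" "l' \<preceq> m'" "inv l' \<preceq> m'"
    "l' \<in> carrier G"
    using l by (meson polarE)
  \<comment> \<open>Orthogonality to some member of \<open>P\<close> is what forces both bounds to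
    be positive.\<close>
  from P obtain p where p: "p \<in> P" "p \<in> carrier G" by auto
  have pos: "\<one> \<preceq> m" "\<one> \<preceq> m'" using orth_one_le m m' p by blast+
  have up: "m \<preceq> m \<otimes> m'" "m' \<preceq> m \<otimes> m'"
    using pos m(1) m'(1) by (auto intro: mult_upper1 mult_upper2)
  show ?thesis
  proof (rule that[of "m \<otimes> m'"])
    show "orth h (m \<otimes> m')" if "h \<in> P" for h
      using that P m m' by (auto intro!: orth_mult)
  qed (use m m' pos le_trans[OF _ up(1)] le_trans[OF _ up(2)] in auto)
qed

lemma polar_mult:
  assumes P: "P \<subseteq> carrier G" "P \<noteq> {}" and l: "l \<in> polar P" "l' \<in> polar P"
  shows "l \<otimes> l' \<in> polar P"
proof -
  obtain m where m: "m \<in> carrier G" "\<one> \<preceq> m" "\<And>h. h \<in> P \<Longrightarrow> orth h m"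
    "l \<preceq> m" "inv l \<preceq> m" "l' \<preceq> m" "inv l' \<preceq> m"
    using polar_common_bound[OF P l] by metis
  have lc: "l \<in> carrier G" "l' \<in> carrier G" using l polar_subset by auto
  have "orth h (m \<otimes> m)" if "h \<in> P" for h
    using that P m by (auto intro!: orth_mult)
  moreover have "l \<otimes> l' \<preceq> m \<otimes> m" "inv (l \<otimes> l') \<preceq> m \<otimes> m"
    using m lc by (auto simp: inv_mult_group intro!: mult_mono)
  ultimately show ?thesis using m lc by (auto simp: polar_def)
qed

lemma conj_mono:
  assumes "x \<preceq> y" "x \<in> carrier G" "y \<in> carrier G" "g \<in> carrier G"
  shows "g \<otimes> x \<otimes> inv g \<preceq> g \<otimes> y \<otimes> inv g"
  using assms by (simp add: mult_le_left mult_le_right)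

text \<open>The conjugate of the bound is a bound: by \<open>orth_conj_iff\<close> its orthogonality
  to \<open>h\<close> is that of \<open>m\<close> to the opposite conjugate of \<open>h\<close>,
  which is again in \<open>P\<close>.\<close>

lemma polar_conj:
  assumes P: "P \<subseteq> carrier G" and g: "g \<in> carrier G" "\<And>h. h \<in> P \<Longrightarrow> inv g \<otimes> h \<otimes> g \<in> P"
    and l: "l \<in> polar P"
  shows "g \<otimes> l \<otimes> inv g \<in> polar P"
proof -
  obtain m where m: "m \<in> carrier G" "\<And>h. h \<in> P \<Longrightarrow> orth h m" "l \<preceq> m" "inv l \<preceq> m" "l \<in> carrier G"
    using l by (meson polarE)
  have "orth h (g \<otimes> m \<otimes> inv g)" if "h \<in> P" for h
    using that P g m(1,2) by (subst orth_conj_iff) auto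
  moreover have "inv (g \<otimes> l \<otimes> inv g) = g \<otimes> inv l \<otimes> inv g"
    using g m by (simp add: inv_mult_group m_assoc)
  ultimately show ?thesis
    using m g conj_mono[OF m(3)] conj_mono[OF m(4)]
    by (auto simp: polar_def intro!: bexI[of _ "g \<otimes> m \<otimes> inv g"])
qed

text \<open>Up to the left factor \<open>m\<close>, the joins
  \<open>l \<otimes> b \<squnion>\<^sub>l l' \<otimes> b'\<close> and
  \<open>b \<squnion>\<^sub>l b'\<close> dominate each other, so \<open>m\<close> bounds the
  quotient and its inverse.\<close>

lemma polar_ljoin_quotient:
  assumes P: "P \<subseteq> carrier G" "P \<noteq> {}" and l: "l \<in> polar P" "l' \<in> polar P"
    and b: "b \<in> carrier G" "b' \<in> carrier G"
  shows "(l \<otimes> b \<squnion>\<^sub>l l' \<otimes> b') \<otimes> inv (b \<squnion>\<^sub>l b') \<in> polar P"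
proof -
  obtain m where m: "m \<in> carrier G" "\<one> \<preceq> m" "\<And>h. h \<in> P \<Longrightarrow> orth h m"
    "l \<preceq> m" "inv l \<preceq> m" "l' \<preceq> m" "inv l' \<preceq> m"
    using polar_common_bound[OF P l] by metis
  have lc: "l \<in> carrier G" "l' \<in> carrier G" using l polar_subset by auto
  have "l \<otimes> b \<squnion>\<^sub>l l' \<otimes> b' \<preceq> m \<otimes> (b \<squnion>\<^sub>l b')"
    using m lc b by (simp add: mult_ljoin_left ljoin_mono mult_le_right)
  then have 1: "(l \<otimes> b \<squnion>\<^sub>l l' \<otimes> b') \<otimes> inv (b \<squnion>\<^sub>l b') \<preceq> m"
    using m lc b by (intro le_mult_inv) auto
  \<comment> \<open>Multiply \<open>inv l \<preceq> m\<close> on the right by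
    \<open>l \<otimes> b\<close>, and likewise for \<open>l'\<close>.\<close>
  have "b \<preceq> m \<otimes> (l \<otimes> b)" "b' \<preceq> m \<otimes> (l' \<otimes> b')"
    using mult_le_right[OF m(5), of "l \<otimes> b"] mult_le_right[OF m(7), of "l' \<otimes> b'"] m lc b
    by simp_all
  then have "b \<squnion>\<^sub>l b' \<preceq> m \<otimes> (l \<otimes> b \<squnion>\<^sub>l l' \<otimes> b')"
    using m lc b by (simp add: mult_ljoin_left ljoin_mono)
  then have "(b \<squnion>\<^sub>l b') \<otimes> inv (l \<otimes> b \<squnion>\<^sub>l l' \<otimes> b') \<preceq> m"
    using m lc b by (intro le_mult_inv) auto
  then show ?thesis
    using 1 m lc b by (auto simp: polar_def inv_mult_group intro!: bexI[of _ m])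
qed

end

text \<open>Right translation by \<open>y\<close> reduces an arbitrary join to a join with
  \<open>\<one>\<close> of the quotient of \<open>x\<close> by \<open>y\<close>.\<close>

lemma lgroup_hom_I_pos:
  assumes G: "lgroup G" and H: "lgroup H" and f: "f \<in> hom G H"
    and pos: "\<And>x. x \<in> carrier G \<Longrightarrow> f (x \<squnion>\<^sub>l\<^bsub>G\<^esub> \<one>\<^bsub>G\<^esub>) = f x \<squnion>\<^sub>l\<^bsub>H\<^esub> \<one>\<^bsub>H\<^esub>"
  shows "f \<in> lgroup_hom G H"
proof (rule lgroup_hom_I)
  interpret G: lgroup G by fact
  interpret H: lgroup H by fact
  interpret group_hom G H f using f by unfold_locales
  fix x y assume xy: "x \<in> carrier G" "y \<in> carrier G"
  let ?z = "x \<otimes>\<^bsub>G\<^esub> inv\<^bsub>G\<^esub> y"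
  have "x \<squnion>\<^sub>l\<^bsub>G\<^esub> y = (?z \<squnion>\<^sub>l\<^bsub>G\<^esub> \<one>\<^bsub>G\<^esub>) \<otimes>\<^bsub>G\<^esub> y" using xy by (simp add: G.mult_ljoin_right G.m_assoc)
  then have "f (x \<squnion>\<^sub>l\<^bsub>G\<^esub> y) = (f ?z \<squnion>\<^sub>l\<^bsub>H\<^esub> \<one>\<^bsub>H\<^esub>) \<otimes>\<^bsub>H\<^esub> f y"
    using xy by (simp add: pos del: hom_mult) (simp add: pos)
  also have "\<dots> = f x \<squnion>\<^sub>l\<^bsub>H\<^esub> f y" using xy by (simp add: H.mult_ljoin_right H.m_assoc)
  finally show "f (x \<squnion>\<^sub>l\<^bsub>G\<^esub> y) = f x \<squnion>\<^sub>l\<^bsub>H\<^esub> f y" .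
qed (use f in \<open>auto simp: hom_def\<close>)

section \<open>The candidate centralizer of an arrow of points\<close>

text \<open>Interpreted a second time for a competing arrow \<open>b\<close>, so that both arrows
  share the same rules.\<close>

locale point_arrow =
  fixes B :: "'b lgroup" and Z :: "('a, 'b) point" and X :: "('c, 'b) point" and a :: "'c \<Rightarrow> 'a"
  assumes B: "lgroup B" and Z: "is_point B Z" and X: "is_point B X" and a: "a \<in> pt_hom B X Z"
begin

sublocale B: lgroup B by (rule B)
sublocale A: lgroup "obj Z" using Z by (simp add: is_point_def)
sublocale X: lgroup "obj X" using X by (simp add: is_point_def)

abbreviation "A \<equiv> obj Z"
abbreviation "sp y \<equiv> sect Z (proj Z y)"

lemma homs:
  "proj Z \<in> lgroup_hom A B" "sect Z \<in> lgroup_hom B A"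
  "proj X \<in> lgroup_hom (obj X) B" "sect X \<in> lgroup_hom B (obj X)" "a \<in> lgroup_hom (obj X) A"
  using Z X a by (auto simp: is_point_def pt_hom_def)

lemmas homs_D [simp] = homs[THEN lgroup_hom_D(1)] homs[THEN lgroup_hom_D(2)] homs[THEN lgroup_hom_D(3)]

lemmas homs_one [simp] =
  lgroup_hom_one[OF A.lgroup_axioms B homs(1)] lgroup_hom_one[OF B A.lgroup_axioms homs(2)]
  lgroup_hom_one[OF X.lgroup_axioms B homs(3)] lgroup_hom_one[OF B X.lgroup_axioms homs(4)]
  lgroup_hom_one[OF X.lgroup_axioms A.lgroup_axioms homs(5)]

lemmas homs_inv [simp] =
  lgroup_hom_inv[OF A.lgroup_axioms B homs(1)] lgroup_hom_inv[OF B A.lgroup_axioms homs(2)]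
  lgroup_hom_inv[OF X.lgroup_axioms B homs(3)] lgroup_hom_inv[OF B X.lgroup_axioms homs(4)]
  lgroup_hom_inv[OF X.lgroup_axioms A.lgroup_axioms homs(5)]

lemma sections [simp]:
  "b \<in> carrier B \<Longrightarrow> proj Z (sect Z b) = b" "b \<in> carrier B \<Longrightarrow> proj X (sect X b) = b"
  using Z X by (auto simp: is_point_def)

lemma arrow [simp]:
  "x \<in> carrier (obj X) \<Longrightarrow> proj Z (a x) = proj X x" "b \<in> carrier B \<Longrightarrow> a (sect X b) = sect Z b"
  using a by (auto simp: pt_hom_def)

lemma arrow_mono: "\<lbrakk>X.le x y; x \<in> carrier (obj X); y \<in> carrier (obj X)\<rbrakk> \<Longrightarrow> A.le (a x) (a y)"
  by (simp add: A.le_def X.le_def flip: lgroup_hom_D(3)[OF homs(5)])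

text \<open>Only positive elements are taken, as \<open>orth\<close> forces positivity; quotients of
  them recover the whole image of the kernel.\<close>

definition ker_pos :: "'a set" where
  "ker_pos = a ` {x \<in> carrier (obj X). proj X x = \<one>\<^bsub>B\<^esub> \<and> X.le \<one>\<^bsub>obj X\<^esub> x}"

text \<open>The quotient of \<open>y\<close> by \<open>sp y\<close> always lies in the kernel of
  \<open>proj Z\<close>. Thus \<open>cent\<close> consists of the products of a kernel element of
  the polar with a section value.\<close>

definition cent :: "'a set" where
  "cent = {y \<in> carrier A. y \<otimes>\<^bsub>A\<^esub> inv\<^bsub>A\<^esub> sp y \<in> A.polar ker_pos}"

lemma ker_pos_subset: "ker_pos \<subseteq> carrier A"
  by (auto simp: ker_pos_def)

lemma one_in_ker_pos: "\<one>\<^bsub>A\<^esub> \<in> ker_pos"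
  unfolding ker_pos_def by (rule image_eqI[of _ _ "\<one>\<^bsub>obj X\<^esub>"]) auto

lemma ker_pos_ne: "ker_pos \<noteq> {}"
  using one_in_ker_pos by auto

lemma ker_pos_ge_one: "h \<in> ker_pos \<Longrightarrow> A.le \<one>\<^bsub>A\<^esub> h"
  using arrow_mono[of "\<one>\<^bsub>obj X\<^esub>"] by (auto simp: ker_pos_def)

text \<open>Conjugation by \<open>sect X b\<close> preserves the kernel and the order in
  \<open>X\<close>, and \<open>a\<close> carries it to conjugation by
  \<open>sect Z b\<close>.\<close>

lemma ker_pos_conj:
  assumes "h \<in> ker_pos" "b \<in> carrier B"
  shows "inv\<^bsub>A\<^esub> sect Z b \<otimes>\<^bsub>A\<^esub> h \<otimes>\<^bsub>A\<^esub> sect Z b \<in> ker_pos"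
proof -
  obtain x where x: "h = a x" "x \<in> carrier (obj X)" "proj X x = \<one>\<^bsub>B\<^esub>" "X.le \<one>\<^bsub>obj X\<^esub> x"
    using assms by (auto simp: ker_pos_def)
  have "X.le \<one>\<^bsub>obj X\<^esub> (inv\<^bsub>obj X\<^esub> sect X b \<otimes>\<^bsub>obj X\<^esub> x \<otimes>\<^bsub>obj X\<^esub> sect X b)"
    using X.conj_mono[OF x(4), of "inv\<^bsub>obj X\<^esub> sect X b"] x assms by simp
  then show ?thesis
    unfolding ker_pos_def using x assms
    by (intro image_eqI[of _ _ "inv\<^bsub>obj X\<^esub> sect X b \<otimes>\<^bsub>obj X\<^esub> x \<otimes>\<^bsub>obj X\<^esub> sect X b"]) auto
qed

text \<open>Here \<open>h\<close> is the image under \<open>a\<close> of the kernel component of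
  \<open>x\<close>, and \<open>a\<close> preserves inverses and joins.\<close>

lemma ker_parts:
  assumes x: "x \<in> carrier (obj X)"
  defines "h \<equiv> a x \<otimes>\<^bsub>A\<^esub> inv\<^bsub>A\<^esub> sect Z (proj X x)"
  shows "h \<in> carrier A" "h \<squnion>\<^sub>l\<^bsub>A\<^esub> \<one>\<^bsub>A\<^esub> \<in> ker_pos" "inv\<^bsub>A\<^esub> h \<squnion>\<^sub>l\<^bsub>A\<^esub> \<one>\<^bsub>A\<^esub> \<in> ker_pos"
proof -
  let ?x = "x \<otimes>\<^bsub>obj X\<^esub> inv\<^bsub>obj X\<^esub> sect X (proj X x)"
  have h: "h = a ?x" using x by (simp add: h_def)
  have c: "?x \<in> carrier (obj X)" "proj X ?x = \<one>\<^bsub>B\<^esub>" using x by auto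
  show "h \<in> carrier A" using c(1) by (simp add: h del: homs_D(6-10))
  have "u \<squnion>\<^sub>l\<^bsub>obj X\<^esub> \<one>\<^bsub>obj X\<^esub> \<in> {x \<in> carrier (obj X). proj X x = \<one>\<^bsub>B\<^esub> \<and> X.le \<one>\<^bsub>obj X\<^esub> x}"
    if "u \<in> carrier (obj X)" "proj X u = \<one>\<^bsub>B\<^esub>" for u
    using that by auto
  then have *: "a (u \<squnion>\<^sub>l\<^bsub>obj X\<^esub> \<one>\<^bsub>obj X\<^esub>) \<in> ker_pos" if "u \<in> carrier (obj X)" "proj X u = \<one>\<^bsub>B\<^esub>" for u
    using that unfolding ker_pos_def by blast
  show "h \<squnion>\<^sub>l\<^bsub>A\<^esub> \<one>\<^bsub>A\<^esub> \<in> ker_pos" using *[OF c] c(1) by (simp add: h)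
  have "inv\<^bsub>obj X\<^esub> ?x \<in> carrier (obj X)" "proj X (inv\<^bsub>obj X\<^esub> ?x) = \<one>\<^bsub>B\<^esub>" using c by auto
  from *[OF this] show "inv\<^bsub>A\<^esub> h \<squnion>\<^sub>l\<^bsub>A\<^esub> \<one>\<^bsub>A\<^esub> \<in> ker_pos" using c(1) unfolding h
    by (metis X.inv_closed X.one_closed homs_D(15) homs_inv(5) homs_one(5))
qed

lemma polar_conj_sect:
  "\<lbrakk>b \<in> carrier B; l \<in> A.polar ker_pos\<rbrakk>
    \<Longrightarrow> sect Z b \<otimes>\<^bsub>A\<^esub> l \<otimes>\<^bsub>A\<^esub> inv\<^bsub>A\<^esub> sect Z b \<in> A.polar ker_pos"
  using ker_pos_subset ker_pos_conj by (intro A.polar_conj) auto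

lemma cent_split:
  assumes "y \<in> cent"
  obtains l where "l \<in> A.polar ker_pos" "l \<in> carrier A" "y = l \<otimes>\<^bsub>A\<^esub> sp y"
  using assms A.polar_subset
  by (intro that[of "y \<otimes>\<^bsub>A\<^esub> inv\<^bsub>A\<^esub> sp y"]) (auto simp: cent_def A.m_assoc)

lemma centI:
  "\<lbrakk>y \<in> carrier A; l \<in> A.polar ker_pos; l = y \<otimes>\<^bsub>A\<^esub> inv\<^bsub>A\<^esub> sp y\<rbrakk> \<Longrightarrow> y \<in> cent"
  by (simp add: cent_def)

lemma cent_subset: "cent \<subseteq> carrier A"
  by (auto simp: cent_def)

lemma sect_in_cent: "b \<in> carrier B \<Longrightarrow> sect Z b \<in> cent"
  using A.polar_one[OF ker_pos_subset ker_pos_ge_one] by (simp add: cent_def)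

text \<open>As \<open>sp\<close> preserves joins, the kernel component of the join is exactly the
  element treated in \<open>polar_ljoin_quotient\<close>.\<close>

lemma cent_ljoin:
  assumes "y \<in> cent" "y' \<in> cent"
  shows "y \<squnion>\<^sub>l\<^bsub>A\<^esub> y' \<in> cent"
proof -
  obtain l l' where l: "l \<in> A.polar ker_pos" "l \<in> carrier A" "y = l \<otimes>\<^bsub>A\<^esub> sp y"
    "l' \<in> A.polar ker_pos" "l' \<in> carrier A" "y' = l' \<otimes>\<^bsub>A\<^esub> sp y'"
    using cent_split assms by metis
  have c: "y \<in> carrier A" "y' \<in> carrier A" using assms cent_subset by auto
  have "(l \<otimes>\<^bsub>A\<^esub> sp y \<squnion>\<^sub>l\<^bsub>A\<^esub> l' \<otimes>\<^bsub>A\<^esub> sp y') \<otimes>\<^bsub>A\<^esub> inv\<^bsub>A\<^esub> (sp y \<squnion>\<^sub>l\<^bsub>A\<^esub> sp y') \<in> A.polar ker_pos"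
    using l c by (intro A.polar_ljoin_quotient[OF ker_pos_subset ker_pos_ne]) auto
  then show ?thesis using c by (simp add: cent_def flip: l(3,6))
qed

text \<open>This is semidirect product arithmetic: an inverse has a conjugate of the inverse of
  \<open>l\<close> as kernel component, a product has \<open>l\<close> times a conjugate of
  \<open>l'\<close>, and section values conjugate the polar into itself.\<close>

lemma cent_subgroup: "subgroup cent A"
proof (rule A.subgroupI)
  show "cent \<noteq> {}" using sect_in_cent[OF B.one_closed] by auto
  fix y assume y: "y \<in> cent"
  have c: "y \<in> carrier A" using y cent_subset by auto
  obtain l where l: "l \<in> A.polar ker_pos" "l \<in> carrier A" "y = l \<otimes>\<^bsub>A\<^esub> sp y"
    using cent_split y by metis
  have "inv\<^bsub>A\<^esub> y = inv\<^bsub>A\<^esub> sp y \<otimes>\<^bsub>A\<^esub> inv\<^bsub>A\<^esub> l"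
    using l c by (metis A.inv_mult_group homs_D(1,2))
  moreover have "sp (inv\<^bsub>A\<^esub> y) = inv\<^bsub>A\<^esub> sp y" using c by simp
  ultimately show "inv\<^bsub>A\<^esub> y \<in> cent"
    using polar_conj_sect[of "inv\<^bsub>B\<^esub> proj Z y" "inv\<^bsub>A\<^esub> l"] A.polar_inv[OF l(1)] l(2) c
    by (intro centI) auto
  fix y' assume y': "y' \<in> cent"
  have c': "y' \<in> carrier A" using y' cent_subset by auto
  obtain l' where l': "l' \<in> A.polar ker_pos" "l' \<in> carrier A" "y' = l' \<otimes>\<^bsub>A\<^esub> sp y'"
    using cent_split y' by metis
  have "l \<otimes>\<^bsub>A\<^esub> (sp y \<otimes>\<^bsub>A\<^esub> l' \<otimes>\<^bsub>A\<^esub> inv\<^bsub>A\<^esub> sp y) \<in> A.polar ker_pos"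
    using l l' c by (intro A.polar_mult[OF ker_pos_subset ker_pos_ne] polar_conj_sect) auto
  moreover have "l \<otimes>\<^bsub>A\<^esub> (sp y \<otimes>\<^bsub>A\<^esub> l' \<otimes>\<^bsub>A\<^esub> inv\<^bsub>A\<^esub> sp y)
      = (l \<otimes>\<^bsub>A\<^esub> sp y) \<otimes>\<^bsub>A\<^esub> (l' \<otimes>\<^bsub>A\<^esub> sp y') \<otimes>\<^bsub>A\<^esub> inv\<^bsub>A\<^esub> sp (y \<otimes>\<^bsub>A\<^esub> y')"
    using c c' l(2) l'(2) by (simp add: A.m_assoc A.inv_mult_group)
  ultimately show "y \<otimes>\<^bsub>A\<^esub> y' \<in> cent"
    using c c' by (simp add: cent_def flip: l(3) l'(3))
qed (rule cent_subset)

definition centralizer :: "('a, 'b) point" where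
  "centralizer = Z\<lparr>obj := A\<lparr>carrier := cent\<rparr>\<rparr>"

lemma centralizer_simps [simp]:
  "carrier (obj centralizer) = cent" "mult (obj centralizer) = mult A" "one (obj centralizer) = one A"
  "ljoin (obj centralizer) = ljoin A" "proj centralizer = proj Z" "sect centralizer = sect Z"
  by (simp_all add: centralizer_def)

lemma is_point_centralizer: "is_point B centralizer"
  unfolding centralizer_def by (rule is_point_restrict[OF Z cent_subgroup cent_ljoin sect_in_cent])

lemma is_subobject_centralizer: "is_subobject B Z centralizer (\<lambda>y. y)"
  using is_point_centralizer cent_subset
  by (auto simp: is_subobject_def pt_mono_def pt_hom_def intro!: lgroup_hom_I)

section \<open>The cooperator\<close>

text \<open>After cancellation the two sides differ only in the order of \<open>h\<close>, coming
  from \<open>x'\<close>, and \<open>k\<close>, coming from \<open>y\<close>; these commute by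
  \<open>polar_commute\<close>.\<close>

lemma cooperator_mult:
  assumes x: "x \<in> carrier (obj X)" "x' \<in> carrier (obj X)" and y: "y \<in> cent" "y' \<in> cent"
    and p: "proj X x = proj Z y" "proj X x' = proj Z y'"
  shows "(a x \<otimes>\<^bsub>A\<^esub> a x') \<otimes>\<^bsub>A\<^esub> inv\<^bsub>A\<^esub> sp (y \<otimes>\<^bsub>A\<^esub> y') \<otimes>\<^bsub>A\<^esub> (y \<otimes>\<^bsub>A\<^esub> y')
    = (a x \<otimes>\<^bsub>A\<^esub> inv\<^bsub>A\<^esub> sp y \<otimes>\<^bsub>A\<^esub> y) \<otimes>\<^bsub>A\<^esub> (a x' \<otimes>\<^bsub>A\<^esub> inv\<^bsub>A\<^esub> sp y' \<otimes>\<^bsub>A\<^esub> y')"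
proof -
  obtain l where l: "l \<in> A.polar ker_pos" "l \<in> carrier A" "y = l \<otimes>\<^bsub>A\<^esub> sp y"
    using cent_split y by metis
  have c: "y \<in> carrier A" "y' \<in> carrier A" using y cent_subset by auto
  define h where "h = a x' \<otimes>\<^bsub>A\<^esub> inv\<^bsub>A\<^esub> sp y'"
  define k where "k = inv\<^bsub>A\<^esub> sp y \<otimes>\<^bsub>A\<^esub> y"
  \<comment> \<open>With the section value split off on the left instead of the right, the kernel
    component is a conjugate of \<open>l\<close>.\<close>
  have "k = inv\<^bsub>A\<^esub> sp y \<otimes>\<^bsub>A\<^esub> l \<otimes>\<^bsub>A\<^esub> sp y"
    unfolding k_def using c l(2) by (subst l(3)) (simp add: A.m_assoc)
  then have "k \<in> A.polar ker_pos"
    using polar_conj_sect[OF _ l(1), of "inv\<^bsub>B\<^esub> proj Z y"] c by simp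
  then have hk: "h \<otimes>\<^bsub>A\<^esub> k = k \<otimes>\<^bsub>A\<^esub> h"
    using ker_parts[OF x(2)] by (intro A.polar_commute[OF ker_pos_subset]) (auto simp: h_def p)
  have hc: "h \<in> carrier A" "k \<in> carrier A" using x c by (auto simp: h_def k_def)
  have "(a x \<otimes>\<^bsub>A\<^esub> a x') \<otimes>\<^bsub>A\<^esub> inv\<^bsub>A\<^esub> sp (y \<otimes>\<^bsub>A\<^esub> y') \<otimes>\<^bsub>A\<^esub> (y \<otimes>\<^bsub>A\<^esub> y')
      = a x \<otimes>\<^bsub>A\<^esub> (h \<otimes>\<^bsub>A\<^esub> k) \<otimes>\<^bsub>A\<^esub> y'"
    using x c by (simp add: h_def k_def A.m_assoc A.inv_mult_group)
  also have "\<dots> = a x \<otimes>\<^bsub>A\<^esub> (k \<otimes>\<^bsub>A\<^esub> h) \<otimes>\<^bsub>A\<^esub> y'" by (simp add: hk)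
  also have "\<dots> = (a x \<otimes>\<^bsub>A\<^esub> inv\<^bsub>A\<^esub> sp y \<otimes>\<^bsub>A\<^esub> y) \<otimes>\<^bsub>A\<^esub> (a x' \<otimes>\<^bsub>A\<^esub> inv\<^bsub>A\<^esub> sp y' \<otimes>\<^bsub>A\<^esub> y')"
    using x c by (simp add: h_def k_def A.m_assoc)
  finally show ?thesis .
qed

text \<open>The factor before the positive part of \<open>y\<close> is the defect of
  \<open>h\<close> at \<open>sp y\<close>. By invariance it is also the defect at \<open>y\<close>
  itself, and there it turns the positive part of \<open>y\<close> into that of \<open>h\<close>
  times \<open>y\<close>.\<close>

lemma cooperator_pos:
  assumes x: "x \<in> carrier (obj X)" and y: "y \<in> cent" and p: "proj X x = proj Z y"
  shows "(a x \<squnion>\<^sub>l\<^bsub>A\<^esub> \<one>\<^bsub>A\<^esub>) \<otimes>\<^bsub>A\<^esub> inv\<^bsub>A\<^esub> sp (y \<squnion>\<^sub>l\<^bsub>A\<^esub> \<one>\<^bsub>A\<^esub>) \<otimes>\<^bsub>A\<^esub> (y \<squnion>\<^sub>l\<^bsub>A\<^esub> \<one>\<^bsub>A\<^esub>)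
    = a x \<otimes>\<^bsub>A\<^esub> inv\<^bsub>A\<^esub> sp y \<otimes>\<^bsub>A\<^esub> y \<squnion>\<^sub>l\<^bsub>A\<^esub> \<one>\<^bsub>A\<^esub>"
proof -
  obtain l where l: "l \<in> A.polar ker_pos" "l \<in> carrier A" "y = l \<otimes>\<^bsub>A\<^esub> sp y"
    using cent_split y by metis
  have c: "y \<in> carrier A" using y cent_subset by auto
  define h where "h = a x \<otimes>\<^bsub>A\<^esub> inv\<^bsub>A\<^esub> sp y"
  note h = ker_parts[OF x, unfolded p, folded h_def]
  have ax: "a x = h \<otimes>\<^bsub>A\<^esub> sp y" using x c by (simp add: h_def A.m_assoc)
  have "(a x \<squnion>\<^sub>l\<^bsub>A\<^esub> \<one>\<^bsub>A\<^esub>) \<otimes>\<^bsub>A\<^esub> inv\<^bsub>A\<^esub> sp (y \<squnion>\<^sub>l\<^bsub>A\<^esub> \<one>\<^bsub>A\<^esub>) = A.defect h (sp y)"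
    using c by (simp add: A.defect_def ax)
  also have "\<dots> = A.defect h (l \<otimes>\<^bsub>A\<^esub> sp y)"
    using A.polar_defect[OF ker_pos_subset h(2,3,1) l(1)] c by simp
  finally show ?thesis
    using A.defect_mult[OF h(1) c] by (simp add: h_def flip: l(3))
qed

lemma cooperate_centralizer: "cooperate B Z X a centralizer (\<lambda>y. y)"
proof -
  \<comment> \<open>If \<open>a x\<close> is \<open>h\<close> times \<open>sp y\<close> and
    \<open>y\<close> is \<open>l\<close> times \<open>sp y\<close>, the value is the product of
    \<open>h\<close>, \<open>l\<close> and \<open>sp y\<close>; this form needs no choice of
    components.\<close>
  define \<phi> where "\<phi> = (\<lambda>(x, y). a x \<otimes>\<^bsub>A\<^esub> inv\<^bsub>A\<^esub> sp y \<otimes>\<^bsub>A\<^esub> y)"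
  have c: "y \<in> carrier A" if "y \<in> cent" for y using that cent_subset by auto
  have "\<phi> \<in> lgroup_hom (obj (pt_prod X centralizer)) A"
  proof (rule lgroup_hom_I_pos)
    show "lgroup (obj (pt_prod X centralizer))"
      using is_point_prod[OF B X is_point_centralizer] by (simp add: is_point_def)
    show "\<phi> \<in> hom (obj (pt_prod X centralizer)) A"
      using cooperator_mult c by (auto simp: hom_def pt_prod_def \<phi>_def)
  qed (use cooperator_pos c in \<open>auto simp: pt_prod_def \<phi>_def A.lgroup_axioms\<close>)
  then have "\<phi> \<in> pt_hom B (pt_prod X centralizer) Z"
    using c by (auto simp: pt_hom_def pt_prod_def \<phi>_def)
  then show ?thesis
    unfolding cooperate_def
    by (rule bexI[rotated]) (auto simp: \<phi>_def pt_zero_def A.m_assoc c)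
qed

section \<open>Maximality of the candidate\<close>

text \<open>For positive kernel elements \<open>x\<close> and \<open>v\<close>, the pairs formed by
  the inverse of \<open>x\<close> with the unit and by the unit with the inverse of \<open>v\<close>
  have the unit pair as join. Applying \<open>\<phi>\<close> gives orthogonality of
  \<open>a x\<close> and \<open>b v\<close>.\<close>

lemma cooperating_in_cent:
  assumes Y: "is_point B Y" and b: "b \<in> pt_hom B Y Z" and co: "cooperate B Z X a Y b"
    and y: "y \<in> carrier (obj Y)"
  shows "b y \<in> cent"
proof -
  interpret Y: point_arrow B Z Y b
    using B Z Y b by unfold_locales
  obtain \<phi> where \<phi>: "\<phi> \<in> pt_hom B (pt_prod X Y) Z"
    "\<And>x. x \<in> carrier (obj X) \<Longrightarrow> \<phi> (x, pt_zero X Y x) = a x"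
    "\<And>y. y \<in> carrier (obj Y) \<Longrightarrow> \<phi> (pt_zero Y X y, y) = b y"
    using co by (auto simp: cooperate_def)
  \<comment> \<open>On the kernel the zero arrow is constantly the unit.\<close>
  have \<phi>a: "\<phi> (x, \<one>\<^bsub>obj Y\<^esub>) = a x" if "x \<in> carrier (obj X)" "proj X x = \<one>\<^bsub>B\<^esub>" for x
    using \<phi>(2)[OF that(1)] that by (simp add: pt_zero_def)
  have \<phi>b: "\<phi> (\<one>\<^bsub>obj X\<^esub>, y) = b y" if "y \<in> carrier (obj Y)" "proj Y y = \<one>\<^bsub>B\<^esub>" for y
    using \<phi>(3)[OF that(1)] that by (simp add: pt_zero_def)
  have \<phi>j: "\<phi> (x \<squnion>\<^sub>l\<^bsub>obj X\<^esub> \<one>\<^bsub>obj X\<^esub>, \<one>\<^bsub>obj Y\<^esub> \<squnion>\<^sub>l\<^bsub>obj Y\<^esub> y) = a x \<squnion>\<^sub>l\<^bsub>A\<^esub> b y"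
    if "x \<in> carrier (obj X)" "proj X x = \<one>\<^bsub>B\<^esub>" "y \<in> carrier (obj Y)" "proj Y y = \<one>\<^bsub>B\<^esub>" for x y
  proof -
    have "\<phi> \<in> lgroup_hom (obj (pt_prod X Y)) A" using \<phi> by (simp add: pt_hom_def)
    from lgroup_hom_D(3)[OF this, of "(x, \<one>\<^bsub>obj Y\<^esub>)" "(\<one>\<^bsub>obj X\<^esub>, y)"] show ?thesis
      using that by (simp add: \<phi>a \<phi>b) (simp add: pt_prod_def)
  qed
  define u where "u = y \<otimes>\<^bsub>obj Y\<^esub> inv\<^bsub>obj Y\<^esub> sect Y (proj Y y)"
  \<comment> \<open>The product of the positive and negative parts of \<open>u\<close>, that is, its
    absolute value: one positive kernel element above both \<open>u\<close> and its inverse.\<close>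
  define v where "v = (u \<squnion>\<^sub>l\<^bsub>obj Y\<^esub> \<one>\<^bsub>obj Y\<^esub>) \<otimes>\<^bsub>obj Y\<^esub> (inv\<^bsub>obj Y\<^esub> u \<squnion>\<^sub>l\<^bsub>obj Y\<^esub> \<one>\<^bsub>obj Y\<^esub>)"
  have u: "u \<in> carrier (obj Y)" "proj Y u = \<one>\<^bsub>B\<^esub>" using y by (auto simp: u_def)
  then have v: "v \<in> carrier (obj Y)" "proj Y v = \<one>\<^bsub>B\<^esub>" by (auto simp: v_def)
  have v1: "Y.X.le \<one>\<^bsub>obj Y\<^esub> v" and uv: "Y.X.le u v" "Y.X.le (inv\<^bsub>obj Y\<^esub> u) v"
  proof -
    let ?p = "u \<squnion>\<^sub>l\<^bsub>obj Y\<^esub> \<one>\<^bsub>obj Y\<^esub>" and ?n = "inv\<^bsub>obj Y\<^esub> u \<squnion>\<^sub>l\<^bsub>obj Y\<^esub> \<one>\<^bsub>obj Y\<^esub>"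
    have pn: "Y.X.le ?p v" "Y.X.le ?n v"
      unfolding v_def using u by (auto intro!: Y.X.mult_upper1 Y.X.mult_upper2)
    show "Y.X.le u v" by (rule Y.X.le_trans[OF _ pn(1)]) (use u v in auto)
    show "Y.X.le (inv\<^bsub>obj Y\<^esub> u) v" by (rule Y.X.le_trans[OF _ pn(2)]) (use u v in auto)
    show "Y.X.le \<one>\<^bsub>obj Y\<^esub> v" by (rule Y.X.le_trans[OF _ pn(1)]) (use u v in auto)
  qed
  have "A.orth h (b v)" if h: "h \<in> ker_pos" for h
  proof -
    obtain x where x: "h = a x" "x \<in> carrier (obj X)" "proj X x = \<one>\<^bsub>B\<^esub>" "X.le \<one>\<^bsub>obj X\<^esub> x"
      using h by (auto simp: ker_pos_def)
    have "inv\<^bsub>obj X\<^esub> x \<squnion>\<^sub>l\<^bsub>obj X\<^esub> \<one>\<^bsub>obj X\<^esub> = \<one>\<^bsub>obj X\<^esub>"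
      using X.inv_le_one[OF x(4,2)] by (simp add: X.le_def)
    moreover have "\<one>\<^bsub>obj Y\<^esub> \<squnion>\<^sub>l\<^bsub>obj Y\<^esub> inv\<^bsub>obj Y\<^esub> v = \<one>\<^bsub>obj Y\<^esub>"
      using Y.X.inv_le_one[OF v1 v(1)] v by (simp add: Y.X.le_def Y.X.ljoin_comm)
    ultimately have "a (inv\<^bsub>obj X\<^esub> x) \<squnion>\<^sub>l\<^bsub>A\<^esub> b (inv\<^bsub>obj Y\<^esub> v) = \<phi> (\<one>\<^bsub>obj X\<^esub>, \<one>\<^bsub>obj Y\<^esub>)"
      using \<phi>j[of "inv\<^bsub>obj X\<^esub> x" "inv\<^bsub>obj Y\<^esub> v"] x v by simp
    then show ?thesis using x v by (simp add: A.orth_def \<phi>a)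
  qed
  moreover have "A.le (b u) (b v)" "A.le (inv\<^bsub>A\<^esub> b u) (b v)"
    using Y.arrow_mono[OF uv(1)] Y.arrow_mono[OF uv(2)] u v by auto
  \<comment> \<open>The bound required by \<open>polar\<close> is \<open>b v\<close>;
    \<open>b u\<close> is the kernel component of \<open>b y\<close>.\<close>
  ultimately have "b u \<in> A.polar ker_pos" using u v by (auto simp: A.polar_def intro!: bexI[of _ "b v"])
  then show ?thesis using y by (simp add: cent_def u_def)
qed

end

theorem proposition7p3:
  fixes B :: "'b lgroup" and Z :: "('a, 'b) point" and X :: "('c, 'b) point" and a :: "'c \<Rightarrow> 'a"
  assumes "lgroup B" and "is_point B Z" and "is_subobject B Z X a"
  shows "\<exists>(C :: ('a, 'b) point) c. is_centralizer B Z X a C c"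
proof -
  interpret point_arrow B Z X a
    using assms by (simp add: point_arrow_def is_subobject_def pt_mono_def)
  have "subobject_le B Y b centralizer (\<lambda>y. y)"
    if "is_subobject B Z Y b" "cooperate B Z X a Y b" for Y :: "('a, 'b) point" and b
  proof -
    have Y: "is_point B Y" and b: "b \<in> pt_hom B Y Z"
      using that(1) by (auto simp: is_subobject_def pt_mono_def)
    \<comment> \<open>As the values of \<open>b\<close> lie in \<open>cent\<close>, \<open>b\<close>
      itself is the factorization through the inclusion.\<close>
    have "b \<in> pt_hom B Y centralizer"
      using b cooperating_in_cent[OF Y b that(2)] by (auto simp: pt_hom_def lgroup_hom_def hom_def)
    then show ?thesis by (auto simp: subobject_le_def)
  qed
  then show ?thesis
    using is_subobject_centralizer cooperate_centralizer by (auto simp: is_centralizer_def)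
qed

end
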